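(* Let $G$ be a graph, $H$ a connected graph, and $H'$ a connected subgraph of $H$ with diameter $D_{H'}$. Then $\lambda(G,H)\le D_{H'}^2\,\lambda(G,H')$; that is, $\frac{1}{D_{H'}^2}\le \frac{\lambda(G,H')}{\lambda(G,H)}$ (whenever $\lambda(G,H)>0$).
   Context: All graphs are finite and simple. For a graph $G$, $d_v$ denotes the degree of $v$, $u\sim v$ means adjacency, and $\mathrm{vol}(G)=\sum_v d_v$. For a metric space $(X,d)$ and $f:V(G)\to X$ set $R_f(G,X)=\frac{\mathrm{vol}(G)\sum_{u\sim v} d(f(u),f(v))^2}{\sum_{u,v} d(f(u),f(v))^2 d_u d_v}$, where the numerator sum is over edges of $G$ and the denominator sum over unordered pairs of vertices; $\lambda(G,X)=\inf_f R_f(G,X)$ over all $f$ with nonzero denominator. A connected graph $H$ is regarded as the metric space $(V(H),d_H)$ with shortest-path distance, and $\lambda(G,H)=\lambda(G,(V(H),d_H))$. *)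

theory Defs
  imports
    "HOL-Analysis.Abstract_Metric_Spaces"
    "Graph_Theory.Graph_Theory"
begin

text \<open>
  A finite simple graph is a \<open>pair_graph\<close>: its set of arcs \<open>parcs G\<close> is a finite, irreflexive,
  symmetric relation on the finite set \<open>pverts G\<close>. An edge is thus a pair of opposite arcs, and
  the degree of a vertex is its out-degree.
\<close>

definition vol :: "'a pair_pre_digraph \<Rightarrow> real" where
  "vol G = (\<Sum>v\<in>pverts G. real (out_degree G v))"

text \<open>
  Every edge is counted once for each of its two orientations in the sum over \<open>parcs G\<close>, and so is
  every unordered pair of distinct vertices in the sum over \<open>pverts G \<times> pverts G\<close>;
  hence the factors \<open>1/2\<close>. The diagonal pairs \<open>u = v\<close> contribute nothing.
\<close>

definition edge_energy :: "'a pair_pre_digraph \<Rightarrow> 'x metric \<Rightarrow> ('a \<Rightarrow> 'x) \<Rightarrow> real" where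
  "edge_energy G X f = (\<Sum>(u, v)\<in>parcs G. (mdist X (f u) (f v))\<^sup>2) / 2"

definition pair_energy :: "'a pair_pre_digraph \<Rightarrow> 'x metric \<Rightarrow> ('a \<Rightarrow> 'x) \<Rightarrow> real" where
  "pair_energy G X f =
     (\<Sum>(u, v)\<in>pverts G \<times> pverts G.
        (mdist X (f u) (f v))\<^sup>2 * real (out_degree G u) * real (out_degree G v)) / 2"

definition rayleigh :: "'a pair_pre_digraph \<Rightarrow> 'x metric \<Rightarrow> ('a \<Rightarrow> 'x) \<Rightarrow> real" where
  "rayleigh G X f = vol G * edge_energy G X f / pair_energy G X f"

text \<open>The infimum is \<open>\<infinity>\<close> if no map has a nonzero denominator.\<close>

definition spectral_gap :: "'a pair_pre_digraph \<Rightarrow> 'x metric \<Rightarrow> ereal" where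
  "spectral_gap G X =
     (INF f\<in>{f. f ` pverts G \<subseteq> mspace X \<and> pair_energy G X f \<noteq> 0}. ereal (rayleigh G X f))"

definition graph_dist :: "'a pair_pre_digraph \<Rightarrow> 'a \<Rightarrow> 'a \<Rightarrow> real" where
  "graph_dist H u v = real_of_ereal (wf_digraph.\<mu> H (\<lambda>_. 1) u v)"

text \<open>
  The constructor \<open>metric\<close> is only specified on actual metric spaces; the lemmas
  \<open>mspace_graph_metric\<close> and \<open>mdist_graph_metric\<close> below cover all connected graphs.
\<close>

definition graph_metric :: "'a pair_pre_digraph \<Rightarrow> 'a metric" where
  "graph_metric H = metric (pverts H, graph_dist H)"

definition graph_diameter :: "'a pair_pre_digraph \<Rightarrow> real" where
  "graph_diameter H = Max ((\<lambda>(u, v). graph_dist H u v) ` (pverts H \<times> pverts H))"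

definition graph_spectral_gap :: "'a pair_pre_digraph \<Rightarrow> 'b pair_pre_digraph \<Rightarrow> ereal" where
  "graph_spectral_gap G H = spectral_gap G (graph_metric H)"

abbreviation connected_graph :: "'a pair_pre_digraph \<Rightarrow> bool" where
  "connected_graph H \<equiv> pair_graph H \<and> Digraph_Component.connected (with_proj H)"

lemma (in wf_digraph) awalk_cost_one: "awalk_cost (\<lambda>_. 1) p = real (length p)"
  by (induction p) auto

lemma length_rev_path [simp]: "length (rev_path p) = length p"
  by (induction p) auto

lemma graph_dist_walk:
  assumes "connected_graph H" "u \<in> pverts H" "v \<in> pverts H"
  obtains p where "pre_digraph.awalk (with_proj H) u p v" "graph_dist H u v = real (length p)"
    "\<And>q. pre_digraph.awalk (with_proj H) u q v \<Longrightarrow> length p \<le> length q"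
proof -
  interpret pair_graph H using assms by auto
  have "symmetric (with_proj H)" by (rule pair_sym_arcs)
  moreover have "Digraph_Component.connected (with_proj H)" using assms by blast
  ultimately have "strongly_connected (with_proj H)"
    by (rule symmetric_connected_imp_strongly_connected)
  then have "u \<rightarrow>\<^sup>*\<^bsub>with_proj H\<^esub> v"
    using assms(2,3) by (simp add: strongly_connected_def)
  then have "\<exists>p. awalk u p v" by (simp add: reachable_awalk)
  then obtain p where p: "awalk u p v" "\<And>q. awalk u q v \<Longrightarrow> length p \<le> length q"
    using ex_has_least_nat[of "\<lambda>p. awalk u p v" _ length] by blast
  have "\<mu> (\<lambda>_. 1) u v = ereal (length p)"
    unfolding \<mu>_def awalk_cost_one
    by (rule INF_eqI) (use p in auto)
  then have "graph_dist H u v = real (length p)" by (simp add: graph_dist_def)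
  then show ?thesis by (rule that[OF p(1) _ p(2)])
qed

lemma Metric_space_graph_dist:
  assumes "connected_graph H"
  shows "Metric_space (pverts H) (graph_dist H)"
proof
  interpret pair_graph H using assms by auto
  note W = graph_dist_walk[OF assms]
  show "0 \<le> graph_dist H u v" for u v
    unfolding graph_dist_def by (intro real_of_ereal_pos) (simp add: \<mu>_def awalk_cost_one INF_greatest)
  show "graph_dist H u v = graph_dist H v u" for u v
  proof -
    have "\<mu> (\<lambda>_. 1) u v \<le> \<mu> (\<lambda>_. 1) v u" for u v
      unfolding \<mu>_def awalk_cost_one
    proof (rule INF_greatest)
      fix q assume "q \<in> {p. awalk v p u}"
      then have "awalk u (rev_path q) v" by simp
      then show "(INF p\<in>{p. awalk u p v}. ereal (real (length p))) \<le> ereal (real (length q))"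
        by (intro INF_lower2[of "rev_path q"]) auto
    qed
    then show ?thesis unfolding graph_dist_def using antisym by metis
  qed
  show "graph_dist H u v = 0 \<longleftrightarrow> u = v" if uv: "u \<in> pverts H" "v \<in> pverts H" for u v
  proof -
    obtain p where p: "awalk u p v" "graph_dist H u v = real (length p)"
        "\<And>q. awalk u q v \<Longrightarrow> length p \<le> length q"
      by (rule W[OF uv]) blast
    show ?thesis
    proof
      assume "graph_dist H u v = 0"
      then have "p = []" using p(2) by simp
      then show "u = v" using p(1) by (simp add: awalk_Nil_iff)
    next
      assume "u = v"
      then have "awalk u [] v" using uv by (simp add: awalk_Nil_iff)
      then have "p = []" using p(3) by force
      then show "graph_dist H u v = 0" using p(2) by simp
    qed
  qed
  show "graph_dist H u w \<le> graph_dist H u v + graph_dist H v w"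
    if uvw: "u \<in> pverts H" "v \<in> pverts H" "w \<in> pverts H" for u v w
  proof -
    obtain p where p: "awalk u p v" "graph_dist H u v = real (length p)"
      by (rule W[OF uvw(1,2)]) blast
    obtain q where q: "awalk v q w" "graph_dist H v w = real (length q)"
      by (rule W[OF uvw(2,3)]) blast
    obtain r where r: "awalk u r w" "graph_dist H u w = real (length r)"
        "\<And>q. awalk u q w \<Longrightarrow> length r \<le> length q"
      by (rule W[OF uvw(1,3)]) blast
    have "length r \<le> length p + length q"
      using r(3)[OF awalk_appendI[OF p(1) q(1)]] by simp
    then show ?thesis
      unfolding p(2) q(2) r(2) by linarith
  qed
qed

lemma mspace_graph_metric: "connected_graph H \<Longrightarrow> mspace (graph_metric H) = pverts H"
  unfolding graph_metric_def by (rule Metric_space.mspace_metric[OF Metric_space_graph_dist])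

lemma mdist_graph_metric: "connected_graph H \<Longrightarrow> mdist (graph_metric H) = graph_dist H"
  unfolding graph_metric_def by (rule Metric_space.mdist_metric[OF Metric_space_graph_dist])

end

theory Submission
  imports Defs
begin

text \<open>
  On a connected subgraph \<open>H'\<close> the two distances satisfy \<open>d\<^sub>H \<le> d\<^sub>H\<^sub>' \<le> D d\<^sub>H\<close>, where \<open>D\<close> is the diameter of
  \<open>H'\<close>: a walk in \<open>H'\<close> is a walk in \<open>H\<close>, and distinct vertices have \<open>d\<^sub>H \<ge> 1\<close> and \<open>d\<^sub>H\<^sub>' \<le> D\<close>. Hence
  every test map into \<open>H'\<close> is a test map into \<open>H\<close> whose Rayleigh quotient grows by at most \<open>D\<^sup>2\<close>.
\<close>

lemma graph_dist_subgraph_le: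
  assumes "connected_graph H" "connected_graph H'" "subgraph H' H"
    and "u \<in> pverts H'" "v \<in> pverts H'"
  shows "graph_dist H u v \<le> graph_dist H' u v"
proof -
  interpret H: pair_graph H using assms by auto
  interpret H': pair_graph H' using assms by auto
  have uv: "u \<in> pverts H" "v \<in> pverts H"
    using assms(3-5) by (auto simp: subgraph_def)
  obtain p where p: "pre_digraph.awalk (with_proj H') u p v" "graph_dist H' u v = real (length p)"
    by (rule graph_dist_walk[OF assms(2,4,5)]) (rule that)
  obtain q :: "('a \<times> 'a) list" where q: "graph_dist H u v = real (length q)"
      "\<And>r. H.awalk u r v \<Longrightarrow> length q \<le> length r"
    by (rule graph_dist_walk[OF assms(1) uv]) (rule that)
  \<comment> \<open>The \<open>H'\<close>-geodesic \<open>p\<close> competes with the shortest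
    \<open>H\<close>-walk \<open>q\<close>.\<close>
  have "H.awalk u p v"
    using p(1) assms(3) by (rule H.subgraph_awalk_imp_awalk)
  then show ?thesis using p(2) q by simp
qed

text \<open>Distances are walk lengths, hence integers, so the metric axiom excluding 0 for distinct
  points already forces 1.\<close>

lemma graph_dist_ge_1:
  assumes "connected_graph H" "u \<in> pverts H" "v \<in> pverts H" "u \<noteq> v"
  shows "1 \<le> graph_dist H u v"
proof -
  obtain p :: "('a \<times> 'a) list" where "graph_dist H u v = real (length p)"
    by (rule graph_dist_walk[OF assms(1-3)]) (rule that)
  moreover have "graph_dist H u v \<noteq> 0"
    using Metric_space.zero[OF Metric_space_graph_dist[OF assms(1)] assms(2,3)] assms(4) by simp
  ultimately show ?thesis by (cases p) auto
qed

lemma graph_dist_le_diameter: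
  assumes "pair_graph H" "u \<in> pverts H" "v \<in> pverts H"
  shows "graph_dist H u v \<le> graph_diameter H"
proof -
  interpret pair_graph H by fact
  have "finite (pverts H)" by simp
  then show ?thesis
    unfolding graph_diameter_def using assms(2,3)
    by (intro Max_ge finite_imageI finite_cartesian_product rev_image_eqI[of "(u, v)"]) auto
qed

lemma graph_dist_le_diameter_mult:
  assumes "connected_graph H" "connected_graph H'" "subgraph H' H"
    and "u \<in> pverts H'" "v \<in> pverts H'"
  shows "graph_dist H' u v \<le> graph_diameter H' * graph_dist H u v"
\<comment> \<open>The bound by 1 from below fails on the diagonal, where both sides vanish
  instead.\<close>
proof (cases "u = v")
  case True
  have "u \<in> pverts H" using assms(3,4) by (auto simp: subgraph_def)
  then have "graph_dist H u u = 0" "graph_dist H' u u = 0"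
    using assms by (simp_all add: Metric_space.zero[OF Metric_space_graph_dist])
  with True show ?thesis by simp
next
  case False
  have "u \<in> pverts H" "v \<in> pverts H" using assms(3-5) by (auto simp: subgraph_def)
  with False have "1 \<le> graph_dist H u v" using assms(1) by (simp add: graph_dist_ge_1)
  moreover have le: "graph_dist H' u v \<le> graph_diameter H'"
    using assms(2,4,5) by (simp add: graph_dist_le_diameter)
  \<comment> \<open>Together with \<open>le\<close> this makes the diameter nonnegative, as
    multiplying by it requires.\<close>
  moreover have "0 \<le> graph_dist H' u v"
    using Metric_space.nonneg[OF Metric_space_graph_dist[OF assms(2)]] .
  ultimately have "graph_diameter H' * 1 \<le> graph_diameter H' * graph_dist H u v"
    by (intro mult_left_mono) auto
  with le show ?thesis by simp
qed

lemma vol_nonneg: "0 \<le> vol G"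
  unfolding vol_def by (simp add: sum_nonneg)

lemma edge_energy_nonneg: "0 \<le> edge_energy G X f"
  unfolding edge_energy_def by (simp add: sum_nonneg case_prod_unfold)

lemma pair_energy_nonneg: "0 \<le> pair_energy G X f"
  unfolding pair_energy_def by (simp add: sum_nonneg case_prod_unfold)

lemma edge_energy_mono:
  assumes "pair_wf_digraph G"
    and "\<And>u v. u \<in> pverts G \<Longrightarrow> v \<in> pverts G \<Longrightarrow> mdist X (f u) (f v) \<le> mdist Y (f u) (f v)"
  shows "edge_energy G X f \<le> edge_energy G Y f"
proof -
  interpret pair_wf_digraph G by fact
  have "(mdist X (f (fst e)) (f (snd e)))\<^sup>2 \<le> (mdist Y (f (fst e)) (f (snd e)))\<^sup>2"
    if "e \<in> parcs G" for e
    using that by (intro power_mono assms(2)) (auto intro: arc_fst_in_verts arc_snd_in_verts)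
  then show ?thesis
    unfolding edge_energy_def by (auto simp: case_prod_unfold intro!: divide_right_mono sum_mono)
qed

lemma pair_energy_le_mult:
  assumes "\<And>u v. u \<in> pverts G \<Longrightarrow> v \<in> pverts G \<Longrightarrow>
      mdist X (f u) (f v) \<le> c * mdist Y (f u) (f v)"
  shows "pair_energy G X f \<le> c\<^sup>2 * pair_energy G Y f"
proof -
  have "(mdist X (f u) (f v))\<^sup>2 * real (out_degree G u) * real (out_degree G v) \<le>
      c\<^sup>2 * ((mdist Y (f u) (f v))\<^sup>2 * real (out_degree G u) * real (out_degree G v))"
    if "u \<in> pverts G" "v \<in> pverts G" for u v
  proof -
    have "(mdist X (f u) (f v))\<^sup>2 \<le> c\<^sup>2 * (mdist Y (f u) (f v))\<^sup>2"
      unfolding power_mult_distrib[symmetric] using that by (intro power_mono assms) auto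
    then have "(mdist X (f u) (f v))\<^sup>2 * (real (out_degree G u) * real (out_degree G v)) \<le>
        c\<^sup>2 * (mdist Y (f u) (f v))\<^sup>2 * (real (out_degree G u) * real (out_degree G v))"
      by (rule mult_right_mono) simp
    then show ?thesis by (simp add: mult_ac)
  qed
  then show ?thesis
    unfolding pair_energy_def
    by (auto simp: sum_distrib_left case_prod_unfold intro!: divide_right_mono sum_mono)
qed

text \<open>Passing from \<open>Y\<close> to \<open>X\<close> does not increase the numerator (by
  \<open>le\<close>) and shrinks the denominator by at most the factor \<open>c\<^sup>2\<close> (by
  \<open>ge\<close>); the vertex set of \<open>G\<close> and its degrees stay the same.\<close>

lemma spectral_gap_le_mult:
  assumes "pair_wf_digraph G" "mspace Y \<subseteq> mspace X" "0 < c"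
    and le: "\<And>x y. x \<in> mspace Y \<Longrightarrow> y \<in> mspace Y \<Longrightarrow> mdist X x y \<le> mdist Y x y"
    and ge: "\<And>x y. x \<in> mspace Y \<Longrightarrow> y \<in> mspace Y \<Longrightarrow> mdist Y x y \<le> c * mdist X x y"
  shows "spectral_gap G X \<le> ereal (c\<^sup>2) * spectral_gap G Y"
proof -
  \<comment> \<open>With the factor moved to the left, the infimum stands alone on the right and it
    suffices to bound each test map; if there is none, it is \<infinity>.\<close>
  have "spectral_gap G X / ereal (c\<^sup>2) \<le> spectral_gap G Y"
    unfolding spectral_gap_def[of G Y]
  proof (rule INF_greatest)
    fix f assume f: "f \<in> {f. f ` pverts G \<subseteq> mspace Y \<and> pair_energy G Y f \<noteq> 0}"
    then have pos: "0 < pair_energy G Y f"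
      using pair_energy_nonneg[of G Y f] by auto
    have edge: "edge_energy G X f \<le> edge_energy G Y f"
      using assms(1) f le by (intro edge_energy_mono) auto
    have pair: "pair_energy G Y f \<le> c\<^sup>2 * pair_energy G X f"
      using f ge by (intro pair_energy_le_mult) auto
    \<comment> \<open>The denominator stays nonzero in \<open>X\<close>, so \<open>f\<close> is also
      a test map for \<open>X\<close>.\<close>
    then have "0 < c\<^sup>2 * pair_energy G X f" using pos by linarith
    then have posX: "0 < pair_energy G X f" using assms(3) by (simp add: zero_less_mult_iff)
    have "spectral_gap G X \<le> ereal (rayleigh G X f)"
      unfolding spectral_gap_def using f assms(2) posX by (intro INF_lower) auto
    \<comment> \<open>Expanding the fraction by \<open>c\<^sup>2\<close> produces exactly the
      denominator that \<open>pair\<close> bounds from below.\<close>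
    also have "rayleigh G X f = c\<^sup>2 * (vol G * edge_energy G X f / (c\<^sup>2 * pair_energy G X f))"
      unfolding rayleigh_def using assms(3) by simp
    also have "\<dots> \<le> c\<^sup>2 * rayleigh G Y f"
      unfolding rayleigh_def using edge pair pos
      by (intro mult_left_mono frac_le mult_nonneg_nonneg vol_nonneg edge_energy_nonneg) auto
    finally show "spectral_gap G X / ereal (c\<^sup>2) \<le> ereal (rayleigh G Y f)"
      using assms(3) by (simp add: ereal_divide_le_pos)
  qed
  then show ?thesis using assms(3) by (simp add: ereal_divide_le_pos)
qed

text \<open>Turns the product bound into the ratio form: \<open>a\<close> is a positive real, so one
  may divide by it, while \<open>b\<close> may still be \<infinity>.\<close>

lemma ereal_inverse_le_divide:
  fixes a b :: ereal
  assumes "a \<le> ereal c * b" "0 < c" "0 < a" "a < \<infinity>"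
  shows "ereal (1 / c) \<le> b / a"
  using assms by (cases a; cases b) (auto simp: field_simps)

theorem theorem5p7:
  fixes G :: "'a pair_pre_digraph" and H H' :: "'b pair_pre_digraph"
  assumes "pair_graph G"
    and "connected_graph H"
    and "connected_graph H'"
    and "subgraph H' H"
    and "graph_diameter H' > 0"
  shows "graph_spectral_gap G H \<le> ereal ((graph_diameter H')\<^sup>2) * graph_spectral_gap G H'
    \<and> (0 < graph_spectral_gap G H \<and> graph_spectral_gap G H < \<infinity> \<longrightarrow>
         ereal (1 / (graph_diameter H')\<^sup>2) \<le> graph_spectral_gap G H' / graph_spectral_gap G H)"
proof -
  interpret G: pair_graph G by fact
  have "graph_spectral_gap G H \<le> ereal ((graph_diameter H')\<^sup>2) * graph_spectral_gap G H'"
    unfolding graph_spectral_gap_def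
  proof (rule spectral_gap_le_mult)
    show "pair_wf_digraph G" by unfold_locales
    show "mspace (graph_metric H') \<subseteq> mspace (graph_metric H)"
      using assms(2-4) by (auto simp: mspace_graph_metric subgraph_def)
  qed (use assms in \<open>simp_all add: mspace_graph_metric mdist_graph_metric
        graph_dist_subgraph_le graph_dist_le_diameter_mult\<close>)
  then show ?thesis
    \<comment> \<open>Here \<open>c\<close> is the squared diameter, positive because the diameter
      is.\<close>
    using ereal_inverse_le_divide assms(5) by auto
qed

end
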